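(* Let $(\lambda_n)_{n\ge1}$ be any sequence in $\mathbb C\setminus\{0\}$, and let $\underline a=(a_n)_{n\ge1}$, $\underline b=(b_n)_{n\ge1}$ be sequences with $0<a_n<b_n$ for all $n$. Suppose that $\inf_{n\in\mathbb N} a_n>0$ and \[ \liminf_{n\to\infty}\left(\frac{\Delta_{n+1}}{a_1\cdots a_n}\right)^{1/n}=0, \] where $\Delta_n=\log(b_n/a_n)$. Then $\dim_H I_{\underline a}^{\underline b}(E_{\underline\lambda})\le 1$.
   Context: For $\lambda\in\mathbb C\setminus\{0\}$ let $E_\lambda(z)=\lambda e^z$. For $\underline\lambda=(\lambda_n)_{n\ge1}$ and sequences $\underline a,\underline b$ with $0<a_n<b_n$, \[ I_{\underline a}^{\underline b}(E_{\underline\lambda})=\{z\in\mathbb C:\ a_n\le |E_{\lambda_n}\circ\cdots\circ E_{\lambda_1}(z)|\le b_n \text{ for every sufficiently large } n\in\mathbb N\}. \] $\dim_H$ denotes Hausdorff dimension. *)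

theory Defs
  imports "HOL-Analysis.Analysis"
begin

text \<open>Iterated composition E_{lambda_n} o ... o E_{lambda_1}, sequences indexed from 1.\<close>
fun exp_iter :: "(nat \<Rightarrow> complex) \<Rightarrow> nat \<Rightarrow> complex \<Rightarrow> complex" where
  "exp_iter lam 0 z = z"
| "exp_iter lam (Suc n) z = lam (Suc n) * exp (exp_iter lam n z)"

definition I_set :: "(nat \<Rightarrow> complex) \<Rightarrow> (nat \<Rightarrow> real) \<Rightarrow> (nat \<Rightarrow> real) \<Rightarrow> complex set" where
  "I_set lam a b = {z. \<forall>\<^sub>F n in sequentially. a n \<le> cmod (exp_iter lam n z) \<and> cmod (exp_iter lam n z) \<le> b n}"

definition hausdorff_pre :: "real \<Rightarrow> real \<Rightarrow> 'a::metric_space set \<Rightarrow> ennreal" where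
  "hausdorff_pre s \<delta> A =
     (INF U \<in> {U :: nat \<Rightarrow> 'a set. A \<subseteq> (\<Union>i. U i) \<and> (\<forall>i. bounded (U i) \<and> diameter (U i) \<le> \<delta>)}.
        (\<Sum>i. ennreal (diameter (U i) powr s)))"

definition hausdorff_measure :: "real \<Rightarrow> 'a::metric_space set \<Rightarrow> ennreal" where
  "hausdorff_measure s A = (SUP \<delta> \<in> {0<..}. hausdorff_pre s \<delta> A)"

definition hausdorff_dim :: "'a::metric_space set \<Rightarrow> ereal" where
  "hausdorff_dim A = (INF s \<in> {s::real. 0 < s \<and> hausdorff_measure s A = 0}. ereal s)"

end

theory Submission
  imports Defs
begin

text \<open>
  Let \<open>F n\<close> be the \<open>n\<close>-th iterate and \<open>s > 1\<close>. A point of the set has \<open>F n\<close> in a vertical strip of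
  width \<open>\<Delta> (n + 1)\<close>, which is covered by small pieces and pulled back under the branches of the
  logarithm. A piece of diameter \<open>d\<close> near \<open>w\<close> has preimages of diameter about \<open>d / \<bar>w\<bar>\<close>, spaced
  \<open>2 \<pi>\<close> apart on a vertical line; as the preimages \<open>u\<close> of interest satisfy \<open>\<bar>u\<bar> \<ge> a\<close>, the series of
  \<open>\<bar>u\<bar> powr - s\<close> over them is \<open>O(a powr (1 - s))\<close>. Thus \<open>n\<close> steps cost a factor
  \<open>K ^ n * (a 1 \<cdots> a n) powr (1 - s)\<close>, and covering the strip costs \<open>\<Delta> (n + 1) powr (s - 1)\<close>. The
  product tends to 0 along a subsequence by the assumption on the lower limit. If \<open>a\<close> is small,
  pieces may expand under a pullback; they are then cut into boundedly many smaller ones, which only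
  affects \<open>K\<close>.
\<close>

section \<open>Outer measures\<close>

context
  fixes \<mu> :: "'a set \<Rightarrow> ennreal"
  assumes outer: "outer_measure_space UNIV \<mu>"
begin

lemma outer_measure_space_empty: "\<mu> {} = 0"
  using outer by (simp add: outer_measure_space_def positive_def)

lemma outer_measure_space_mono: "A \<subseteq> B \<Longrightarrow> \<mu> A \<le> \<mu> B"
  using outer by (simp add: outer_measure_space_def increasing_def)

lemma outer_measure_space_UN_le:
  fixes A :: "nat \<Rightarrow> 'a set"
  shows "\<mu> (\<Union>i. A i) \<le> (\<Sum>i. \<mu> (A i))"
proof -
  have "\<mu> (\<Union>i. A i) = \<mu> (\<Union>i. disjointed A i)"
    by (simp add: UN_disjointed_eq)
  also have "\<dots> \<le> (\<Sum>i. \<mu> (disjointed A i))"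
    using outer disjoint_family_disjointed[of A]
    by (simp add: outer_measure_space_def countably_subadditive_def)
  also have "\<dots> \<le> (\<Sum>i. \<mu> (A i))"
    by (intro suminf_le summableI outer_measure_space_mono disjointed_subset)
  finally show ?thesis .
qed

lemma outer_measure_space_null_UN:
  fixes A :: "nat \<Rightarrow> 'a set"
  assumes "\<And>i. \<mu> (A i) = 0"
  shows "\<mu> (\<Union>i. A i) = 0"
  using outer_measure_space_UN_le[of A] assms by simp

lemma outer_measure_space_Un_le: "\<mu> (A \<union> B) \<le> \<mu> A + \<mu> B"
  using outer_measure_space_UN_le[of "binaryset A B"]
  by (simp add: UN_binaryset_eq suminf_binaryset_eq outer_measure_space_empty)

lemma outer_measure_space_le_Diff_null:
  assumes "\<mu> N = 0"
  shows "\<mu> A \<le> \<mu> (A - N)"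
proof -
  have "\<mu> A \<le> \<mu> ((A - N) \<union> N)" by (intro outer_measure_space_mono) blast
  also have "\<dots> \<le> \<mu> (A - N) + \<mu> N" by (rule outer_measure_space_Un_le)
  finally show ?thesis using assms by simp
qed

lemma outer_measure_space_finite_UN_le:
  "finite I \<Longrightarrow> \<mu> (\<Union>i\<in>I. A i) \<le> (\<Sum>i\<in>I. \<mu> (A i))"
proof (induction I rule: finite_induct)
  case (insert i I)
  have "\<mu> (\<Union>i\<in>insert i I. A i) \<le> \<mu> (A i) + \<mu> (\<Union>i\<in>I. A i)"
    using outer_measure_space_Un_le by simp
  then show ?case
    using insert by (auto intro: order_trans add_left_mono)
qed (simp add: outer_measure_space_empty)

lemma outer_measure_space_UN_int_le:
  fixes A :: "int \<Rightarrow> 'a set"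
  assumes "\<And>k. \<mu> (A k) \<le> f (nat \<bar>k\<bar>)"
  shows "\<mu> (\<Union>k. A k) \<le> 2 * (\<Sum>n. f n)"
proof -
  have half: "\<mu> (\<Union>n. A (g n)) \<le> (\<Sum>n. f n)" if "\<And>n. nat \<bar>g n\<bar> = n" for g :: "nat \<Rightarrow> int"
  proof -
    have "\<mu> (\<Union>n. A (g n)) \<le> (\<Sum>n. \<mu> (A (g n)))"
      by (rule outer_measure_space_UN_le)
    also have "\<dots> \<le> (\<Sum>n. f n)"
      using assms[of "g _"] that by (intro suminf_le summableI) simp
    finally show ?thesis .
  qed
  have "(\<Union>k. A k) \<subseteq> (\<Union>n. A (int n)) \<union> (\<Union>n. A (- int n))"
  proof
    fix x assume "x \<in> (\<Union>k. A k)"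
    then obtain k where "x \<in> A k" by blast
    then show "x \<in> (\<Union>n. A (int n)) \<union> (\<Union>n. A (- int n))"
      by (cases k rule: int_cases2) auto
  qed
  then have "\<mu> (\<Union>k. A k) \<le> \<mu> ((\<Union>n. A (int n)) \<union> (\<Union>n. A (- int n)))"
    by (rule outer_measure_space_mono)
  also have "\<dots> \<le> \<mu> (\<Union>n. A (int n)) + \<mu> (\<Union>n. A (- int n))"
    by (rule outer_measure_space_Un_le)
  also have "\<dots> \<le> (\<Sum>n. f n) + (\<Sum>n. f n)"
    by (intro add_mono half) auto
  finally show ?thesis by (simp add: mult_2)
qed

lemma outer_measure_space_vimage_Int:
  fixes f :: "'a \<Rightarrow> 'b"
  shows "outer_measure_space UNIV (\<lambda>B. \<mu> (f -` B \<inter> S))"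
  unfolding outer_measure_space_def positive_def increasing_def countably_subadditive_def
proof (intro conjI ballI impI allI)
  show "\<mu> (f -` {} \<inter> S) = 0" by (simp add: outer_measure_space_empty)
next
  fix A B :: "'b set" assume "A \<subseteq> B"
  then show "\<mu> (f -` A \<inter> S) \<le> \<mu> (f -` B \<inter> S)"
    by (intro outer_measure_space_mono) blast
next
  fix B :: "nat \<Rightarrow> 'b set"
  have "f -` (\<Union>i. B i) \<inter> S = (\<Union>i. f -` B i \<inter> S)" by blast
  then show "\<mu> (f -` (\<Union>i. B i) \<inter> S) \<le> (\<Sum>i. \<mu> (f -` B i \<inter> S))"
    by (simp only: outer_measure_space_UN_le)
qed

end

section \<open>Hausdorff content\<close>

definition diam_le :: "'a::metric_space set \<Rightarrow> real \<Rightarrow> bool" where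
  "diam_le A d \<longleftrightarrow> (\<forall>x\<in>A. \<forall>y\<in>A. dist x y \<le> d)"

lemma diam_leD: "diam_le A d \<Longrightarrow> x \<in> A \<Longrightarrow> y \<in> A \<Longrightarrow> dist x y \<le> d"
  by (simp add: diam_le_def)

lemma diam_le_subset: "diam_le B d \<Longrightarrow> A \<subseteq> B \<Longrightarrow> diam_le A d"
  by (auto simp: diam_le_def)

lemma diam_le_imp_bounded: "diam_le A d \<Longrightarrow> bounded A"
  by (auto simp: diam_le_def bounded_two_points)

text \<open>There is no bound on the diameters of the covering sets: the content vanishes if and only if
  the measure does, since a cover with a small sum consists of small sets.\<close>
definition hausdorff_content :: "real \<Rightarrow> 'a::metric_space set \<Rightarrow> ennreal" where
  "hausdorff_content s = outer_measure (Collect bounded) (\<lambda>A. ennreal (diameter A powr s))"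

lemma ring_of_sets_bounded: "ring_of_sets UNIV (Collect bounded :: 'a::metric_space set set)"
  by (auto simp: ring_of_sets_iff intro: bounded_subset)

lemma positive_diameter_powr: "positive M (\<lambda>A. ennreal (diameter A powr s))"
  by (simp add: positive_def)

lemma increasing_diameter_powr:
  "0 \<le> s \<Longrightarrow> increasing (Collect bounded) (\<lambda>A. ennreal (diameter A powr s))"
  by (auto simp: increasing_def intro!: ennreal_leI powr_mono2 diameter_subset diameter_ge_0)

lemma outer_measure_space_hausdorff_content:
  "0 \<le> s \<Longrightarrow> outer_measure_space UNIV (hausdorff_content s)"
  using ring_of_sets.outer_measure_space_outer_measure
    [OF ring_of_sets_bounded positive_diameter_powr increasing_diameter_powr]
  by (simp add: hausdorff_content_def)

lemma hausdorff_content_le_diameter: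
  assumes "bounded A" "0 \<le> s"
  shows "hausdorff_content s A \<le> ennreal (diameter A powr s)"
proof -
  have "hausdorff_content s A \<le> (\<Sum>i. ennreal (diameter (binaryset A {} i) powr s))"
    unfolding hausdorff_content_def using assms
    by (intro ring_of_sets.outer_measure_le[OF ring_of_sets_bounded] positive_diameter_powr
        increasing_diameter_powr) (auto simp: range_binaryset_eq UN_binaryset_eq)
  then show ?thesis
    by (simp add: suminf_binaryset_eq[where f = "\<lambda>A. ennreal (diameter A powr s)"]
        del: suminf_ennreal)
qed

lemma hausdorff_content_diam_le:
  assumes "diam_le A d" "0 \<le> d" "0 \<le> s"
  shows "hausdorff_content s A \<le> ennreal (d powr s)"
proof -
  have "diameter A \<le> d"
    using assms(1,2) by (auto simp: diameter_def diam_le_def intro!: cSUP_least)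
  then have "ennreal (diameter A powr s) \<le> ennreal (d powr s)"
    using assms by (intro ennreal_leI powr_mono2 diameter_ge_0 diam_le_imp_bounded)
  then show ?thesis
    using hausdorff_content_le_diameter[OF diam_le_imp_bounded[OF assms(1)] assms(3)]
    by (rule order_trans[rotated])
qed

lemma hausdorff_measure_eq_0:
  assumes "hausdorff_content s A = 0" "0 < s"
  shows "hausdorff_measure s A = 0"
proof -
  have "hausdorff_pre s \<delta> A \<le> 0 + ennreal \<epsilon>" if "0 < \<delta>" "0 < \<epsilon>" for \<delta> \<epsilon>
  proof -
    have "hausdorff_content s A < ennreal (min \<epsilon> (\<delta> powr s))"
      using assms(1) that by simp
    then obtain U where U: "A \<subseteq> (\<Union>i. U i)" "\<And>i. bounded (U i)"
      "(\<Sum>i. ennreal (diameter (U i) powr s)) < ennreal (min \<epsilon> (\<delta> powr s))"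
      unfolding hausdorff_content_def
      by (auto dest!: ring_of_sets.outer_measure_close[OF ring_of_sets_bounded])
    have "diameter (U i) \<le> \<delta>" for i
    proof (rule ccontr)
      assume "\<not> diameter (U i) \<le> \<delta>"
      then have "\<delta> powr s \<le> diameter (U i) powr s"
        using that assms(2) by (intro powr_mono2) auto
      moreover have "ennreal (diameter (U i) powr s) < ennreal (min \<epsilon> (\<delta> powr s))"
        using U(3) by (rule ennreal_suminf_lessD)
      ultimately show False
        by (simp add: ennreal_less_iff)
    qed
    then have "hausdorff_pre s \<delta> A \<le> (\<Sum>i. ennreal (diameter (U i) powr s))"
      unfolding hausdorff_pre_def by (intro INF_lower) (use U in auto)
    also have "\<dots> \<le> ennreal \<epsilon>"
      using less_imp_le[OF U(3)] by (rule order_trans) (simp add: ennreal_leI)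
    finally show ?thesis by simp
  qed
  then have "hausdorff_pre s \<delta> A = 0" if "0 < \<delta>" for \<delta>
    using that ennreal_le_epsilon[of 0 "hausdorff_pre s \<delta> A"] by simp
  then show ?thesis
    by (simp add: hausdorff_measure_def)
qed

lemma hausdorff_dim_le:
  assumes "\<And>s. t < s \<Longrightarrow> hausdorff_content s A = 0" "0 \<le> t"
  shows "hausdorff_dim A \<le> ereal t"
proof (rule ereal_le_epsilon2)
  fix e :: real assume "0 < e"
  then show "hausdorff_dim A \<le> ereal t + ereal e"
    unfolding hausdorff_dim_def using assms
    by (auto intro!: INF_lower2[of "t + e"] hausdorff_measure_eq_0)
qed

section \<open>Partition of boxes\<close>

lemma abs_diff_le_if_floor_eq:
  fixes x y t :: real
  assumes "\<lfloor>x / t\<rfloor> = \<lfloor>y / t\<rfloor>" "0 < t"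
  shows "\<bar>x - y\<bar> \<le> t"
proof -
  have "\<bar>x / t - y / t\<bar> < 1" using assms(1) by linarith
  then show ?thesis using assms(2) by (simp add: field_simps flip: diff_divide_distrib)
qed

lemma dist_le_if_floor_eq:
  fixes v w p :: "'a::euclidean_space" and t :: real
  assumes "\<And>i. i \<in> Basis \<Longrightarrow> \<lfloor>(v - p) \<bullet> i / t\<rfloor> = \<lfloor>(w - p) \<bullet> i / t\<rfloor>" "0 < t"
  shows "dist v w \<le> DIM('a) * t"
proof -
  have "dist v w \<le> (\<Sum>i\<in>Basis. \<bar>(v - w) \<bullet> i\<bar>)"
    by (simp add: dist_norm norm_le_l1)
  also have "\<dots> \<le> (\<Sum>i\<in>(Basis::'a set). t)"
    using abs_diff_le_if_floor_eq[OF assms] by (intro sum_mono) (simp add: inner_diff_left)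
  finally show ?thesis by simp
qed

lemma cbox_grid_partition:
  fixes p q :: "'a::euclidean_space" and t :: real
  assumes "A \<subseteq> cbox p q" "cbox p q \<noteq> {}" "0 < t"
  obtains F where "finite F" "\<Union>F = A" "real (card F) \<le> (\<Prod>i\<in>Basis. (q - p) \<bullet> i / t + 1)"
    "\<And>B. B \<in> F \<Longrightarrow> diam_le B (DIM('a) * t)"
proof
  define g where "g = (\<lambda>w. \<lambda>i\<in>Basis. \<lfloor>(w - p) \<bullet> i / t\<rfloor>)"
  define G where "G = (\<Pi>\<^sub>E i\<in>Basis. {0..\<lfloor>(q - p) \<bullet> i / t\<rfloor>})"
  define F where "F = (\<lambda>k. {w \<in> A. g w = k}) ` G"
  have G: "finite G" unfolding G_def by (intro finite_PiE) auto
  then show "finite F" by (simp add: F_def)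
  have "g w \<in> G" if "w \<in> A" for w
    using that assms(1,3)
    by (auto simp: g_def G_def mem_box inner_diff_left subset_iff
        intro!: floor_mono divide_right_mono)
  then show "\<Union>F = A" by (auto simp: F_def)
  have "real (card F) \<le> real (card G)"
    unfolding F_def using G by (intro of_nat_mono card_image_le)
  also have "\<dots> = (\<Prod>i\<in>Basis. real (nat (\<lfloor>(q - p) \<bullet> i / t\<rfloor> + 1)))"
    by (simp add: G_def card_PiE)
  also have "\<dots> \<le> (\<Prod>i\<in>Basis. (q - p) \<bullet> i / t + 1)"
    using assms(2,3) by (intro prod_mono) (auto simp: box_ne_empty inner_diff_left)
  finally show "real (card F) \<le> (\<Prod>i\<in>Basis. (q - p) \<bullet> i / t + 1)" .
  have "\<lfloor>(v - p) \<bullet> i / t\<rfloor> = \<lfloor>(w - p) \<bullet> i / t\<rfloor>" if "g v = g w" "i \<in> Basis" for v w i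
    using fun_cong[OF that(1), of i] that(2) by (simp add: g_def)
  then have "dist v w \<le> DIM('a) * t" if "g v = g w" for v w
    using that assms(3) by (intro dist_le_if_floor_eq[of v p t w])
  then show "diam_le B (DIM('a) * t)" if "B \<in> F" for B
    using that by (auto simp: F_def diam_le_def)
qed

section \<open>Sums of powers\<close>

lemma powr_diff_ge:
  fixes s x y :: real
  assumes "0 < x" "x < y" "1 \<le> s"
  shows "(s - 1) * (y - x) * y powr (- s) \<le> x powr (1 - s) - y powr (1 - s)"
proof -
  have "((\<lambda>z. z powr (1 - s)) has_real_derivative (1 - s) * z powr (- s)) (at z)" if "x \<le> z" for z
    using assms that by (auto intro!: derivative_eq_intros)
  from MVT2[OF assms(2) this] obtain z where z: "x < z" "z < y"
    "y powr (1 - s) - x powr (1 - s) = (y - x) * ((1 - s) * z powr (- s))"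
    by blast
  have "y powr (- s) \<le> z powr (- s)"
    using z assms by (intro powr_mono2') auto
  then have "(s - 1) * (y - x) * y powr (- s) \<le> (s - 1) * (y - x) * z powr (- s)"
    using assms by (intro mult_left_mono) auto
  then show ?thesis using z(3) by (simp add: algebra_simps)
qed

text \<open>The sum telescopes after comparison with the differences of the powers of exponent \<open>1 - s\<close>.\<close>
lemma sum_max_powr_le:
  fixes c s \<alpha> :: real
  assumes "0 < c" "c \<le> \<alpha>" "1 < s"
  shows "(\<Sum>k<n. max \<alpha> (real k) powr (- s)) \<le> (2 + 1 / c) powr s / (s - 1) * \<alpha> powr (1 - s)"
proof -
  define M where "M = 2 + 1 / c"
  have M: "0 < M" using assms(1) by (simp add: M_def add_pos_pos)
  have term_le: "max \<alpha> (real k) powr (- s)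
      \<le> M powr s / (s - 1) * ((\<alpha> + k) powr (1 - s) - (\<alpha> + Suc k) powr (1 - s))" for k
  proof -
    have "1 \<le> (1 / c) * max \<alpha> (real k)" using assms by (simp add: field_simps)
    then have max_ge: "\<alpha> + Suc k \<le> M * max \<alpha> (real k)"
      unfolding M_def distrib_right by simp
    have "max \<alpha> (real k) powr (- s) = M powr s * (M * max \<alpha> (real k)) powr (- s)"
      using M assms by (simp add: powr_mult powr_minus)
    also have "\<dots> \<le> M powr s * (\<alpha> + Suc k) powr (- s)"
      using assms max_ge by (intro mult_left_mono powr_mono2') auto
    also have "\<dots> = M powr s / (s - 1) *
        ((s - 1) * ((\<alpha> + Suc k) - (\<alpha> + k)) * (\<alpha> + Suc k) powr (- s))"
      using assms by simp
    also have "\<dots> \<le> M powr s / (s - 1) * ((\<alpha> + k) powr (1 - s) - (\<alpha> + Suc k) powr (1 - s))"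
      using assms by (intro mult_left_mono powr_diff_ge) auto
    finally show ?thesis .
  qed
  have "(\<Sum>k<n. max \<alpha> (real k) powr (- s))
      \<le> (\<Sum>k<n. M powr s / (s - 1) * ((\<alpha> + k) powr (1 - s) - (\<alpha> + Suc k) powr (1 - s)))"
    by (intro sum_mono term_le)
  also have "\<dots> = M powr s / (s - 1) * (\<alpha> powr (1 - s) - (\<alpha> + n) powr (1 - s))"
    unfolding sum_distrib_left[symmetric]
    using sum_lessThan_telescope'[of "\<lambda>k. (\<alpha> + real k) powr (1 - s)" n] by simp
  also have "\<dots> \<le> M powr s / (s - 1) * \<alpha> powr (1 - s)"
    using assms by (intro mult_left_mono) auto
  finally show ?thesis unfolding M_def .
qed

lemma suminf_max_powr_le:
  fixes c s \<alpha> X :: real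
  assumes "0 < c" "c \<le> \<alpha>" "1 < s" "0 \<le> X"
  shows "(\<Sum>k. ennreal (X * max \<alpha> (real k) powr (- s)))
    \<le> ennreal (X * ((2 + 1 / c) powr s / (s - 1) * \<alpha> powr (1 - s)))"
proof (rule suminf_le_const)
  fix n
  have "(\<Sum>k<n. ennreal (X * max \<alpha> (real k) powr (- s)))
      = ennreal (X * (\<Sum>k<n. max \<alpha> (real k) powr (- s)))"
    using assms(4) by (simp add: sum_distrib_left)
  also have "\<dots> \<le> ennreal (X * ((2 + 1 / c) powr s / (s - 1) * \<alpha> powr (1 - s)))"
    using assms by (intro ennreal_leI mult_left_mono sum_max_powr_le)
  finally show "(\<Sum>k<n. ennreal (X * max \<alpha> (real k) powr (- s)))
    \<le> ennreal (X * ((2 + 1 / c) powr s / (s - 1) * \<alpha> powr (1 - s)))" .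
qed auto

section \<open>Branches of the logarithm\<close>

lemma lipschitz_on_Ln:
  assumes "0 < \<delta>"
  shows "(1 / \<delta>)-lipschitz_on {z. \<delta> \<le> Re z} Ln"
proof (rule lipschitz_onI)
  fix w w' assume "w \<in> {z. \<delta> \<le> Re z}" "w' \<in> {z. \<delta> \<le> Re z}"
  have "cmod (Ln w - Ln w') \<le> 1 / \<delta> * cmod (w - w')"
  proof (rule field_differentiable_bound[where S = "{z. \<delta> \<le> Re z}"])
    show "convex {z. \<delta> \<le> Re z}" by (rule convex_halfspace_Re_ge)
    fix z assume z: "z \<in> {z. \<delta> \<le> Re z}"
    then show "(Ln has_field_derivative inverse z) (at z within {z. \<delta> \<le> Re z})"
      using assms
      by (intro has_field_derivative_Ln has_field_derivative_at_within)
        (auto simp: complex_nonpos_Reals_iff)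
    have "\<delta> \<le> cmod z" using z complex_Re_le_cmod[of z] by simp
    then show "cmod (inverse z) \<le> 1 / \<delta>"
      using assms le_imp_inverse_le[of \<delta> "cmod z"]
      by (simp add: norm_inverse norm_divide inverse_eq_divide)
  qed fact+
  then show "dist (Ln w) (Ln w') \<le> 1 / \<delta> * dist w w'" by (simp add: dist_norm)
qed (use assms in simp)

lemma Re_divide_ge_half:
  assumes "cmod (w - w0) \<le> cmod w0 / 2" "w0 \<noteq> 0"
  shows "1 / 2 \<le> Re (w / w0)"
proof -
  have "cmod (1 - w / w0) = cmod (w - w0) / cmod w0"
    using assms(2) by (simp add: norm_minus_commute diff_divide_distrib flip: norm_divide)
  also have "\<dots> \<le> 1 / 2" using assms by (simp add: field_simps)
  finally show ?thesis using abs_Re_le_cmod[of "1 - w / w0"] by simp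
qed

lemma dist_Ln_divide_le:
  assumes "diam_le P d" "P \<subseteq> - ball 0 r" "0 < r" "2 * d \<le> r" "w0 \<in> P" "w \<in> P" "w' \<in> P"
  shows "dist (Ln (w / w0)) (Ln (w' / w0)) \<le> 2 * d / r"
proof -
  have w0: "r \<le> cmod w0" "w0 \<noteq> 0" using assms(2,3,5) by auto
  have "1 / 2 \<le> Re (u / w0)" if "u \<in> P" for u
    using diam_leD[OF assms(1) that assms(5)] assms(4) w0
    by (intro Re_divide_ge_half) (auto simp: dist_norm)
  then have "dist (Ln (w / w0)) (Ln (w' / w0)) \<le> 2 * dist (w / w0) (w' / w0)"
    using lipschitz_onD[OF lipschitz_on_Ln[of "1 / 2"]] assms(6,7) by simp
  also have "\<dots> = 2 * dist w w' / cmod w0"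
    by (simp add: dist_norm norm_divide flip: diff_divide_distrib)
  also have "\<dots> \<le> 2 * d / r"
    using diam_leD[OF assms(1,6,7)] assms(3) w0(1)
    by (intro frac_le mult_left_mono) (auto intro: order_trans[OF zero_le_dist])
  finally show ?thesis .
qed

definition period_translate :: "int \<Rightarrow> complex set \<Rightarrow> complex set" where
  "period_translate k Q = {u. u - of_int k * (2 * pi * \<i>) \<in> Q}"

lemma diam_le_period_translate:
  assumes "diam_le Q d"
  shows "diam_le (period_translate k Q) d"
  unfolding diam_le_def
proof (intro ballI)
  fix u v assume "u \<in> period_translate k Q" "v \<in> period_translate k Q"
  then show "dist u v \<le> d"
    using diam_leD[OF assms, of "u - of_int k * (2 * pi * \<i>)" "v - of_int k * (2 * pi * \<i>)"]
    by (simp add: period_translate_def dist_norm)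
qed

lemma period_translate_outside_ball:
  assumes "\<And>u. u \<in> Q \<Longrightarrow> \<bar>Im u\<bar> \<le> pi + 1"
  shows "period_translate k Q \<subseteq> - ball 0 \<bar>real_of_int k\<bar>"
proof
  fix u assume "u \<in> period_translate k Q"
  then have "\<bar>Im (u - of_int k * (2 * pi * \<i>))\<bar> \<le> pi + 1"
    using assms[of "u - of_int k * (2 * pi * \<i>)"] by (simp add: period_translate_def)
  then have Im_ge: "\<bar>real_of_int k\<bar> * (2 * pi) \<le> \<bar>Im u\<bar> + pi + 1"
    by (simp add: abs_if split: if_splits)
  have "\<bar>real_of_int k\<bar> \<le> \<bar>Im u\<bar>"
  proof (cases "k = 0")
    case False
    then have "1 * (2 * pi - 1) \<le> \<bar>real_of_int k\<bar> * (2 * pi - 1)"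
      using pi_gt3 by (intro mult_right_mono) auto
    then show ?thesis using Im_ge pi_gt3 by (simp add: algebra_simps)
  qed simp
  also have "\<dots> \<le> cmod u" by (rule abs_Im_le_cmod)
  finally show "u \<in> - ball 0 \<bar>real_of_int k\<bar>" by simp
qed

lemma Ln_branch_eq_up_to_period:
  assumes "l \<noteq> 0" "l * exp v = w0" "w0 \<noteq> 0"
  obtains k :: int where "u - of_int k * (2 * pi * \<i>) = v + Ln (l * exp u / w0)"
proof -
  have "exp (v + Ln (l * exp u / w0)) = exp u"
    using assms by (auto simp: exp_add field_simps)
  then obtain k :: int where "u = v + Ln (l * exp u / w0) + of_int (2 * k) * pi * \<i>"
    by (metis exp_eq)
  then show ?thesis
    using that[of k] by (simp add: algebra_simps)
qed

text \<open>A base point \<open>v\<close> with \<open>\<bar>Im v\<bar> \<le> \<pi>\<close> gives the bound on the imaginary parts.\<close>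
lemma exp_vimage_branch:
  assumes "l \<noteq> 0" "diam_le P d" "P \<subseteq> - ball 0 r" "0 < r" "2 * d \<le> r"
  obtains Q where "diam_le Q (2 * d / r)" "\<And>u. u \<in> Q \<Longrightarrow> \<bar>Im u\<bar> \<le> pi + 1"
    "(\<lambda>u. l * exp u) -` P \<subseteq> (\<Union>k. period_translate k Q)"
proof (cases "P = {}")
  case True
  then show ?thesis using that[of "{}"] by (simp add: diam_le_def)
next
  case False
  then obtain w0 where w0: "w0 \<in> P" by blast
  then have "w0 \<noteq> 0" using assms(3,4) by auto
  define v where "v = Ln (w0 / l)"
  define Q where "Q = (\<lambda>w. v + Ln (w / w0)) ` P"
  have v: "l * exp v = w0" "\<bar>Im v\<bar> \<le> pi"
    using assms(1) \<open>w0 \<noteq> 0\<close> Im_Ln_le_pi[of "w0 / l"] mpi_less_Im_Ln[of "w0 / l"]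
    by (auto simp: v_def)
  note dist_Ln = dist_Ln_divide_le[OF assms(2-5) w0]
  show ?thesis
  proof (rule that)
    show "diam_le Q (2 * d / r)"
      using dist_Ln by (auto simp: Q_def diam_le_def)
  next
    fix u assume "u \<in> Q"
    then obtain w where w: "w \<in> P" "u = v + Ln (w / w0)" by (auto simp: Q_def)
    have "cmod (Ln (w / w0)) \<le> 2 * d / r" using dist_Ln[OF w(1) w0] \<open>w0 \<noteq> 0\<close> by simp
    also have "\<dots> \<le> 1" using assms(4,5) by simp
    finally have "\<bar>Im (Ln (w / w0))\<bar> \<le> 1" using abs_Im_le_cmod order_trans by blast
    then show "\<bar>Im u\<bar> \<le> pi + 1" using v(2) w(2) by simp
  next
    show "(\<lambda>u. l * exp u) -` P \<subseteq> (\<Union>k. period_translate k Q)"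
    proof
      fix u assume "u \<in> (\<lambda>u. l * exp u) -` P"
      moreover obtain k :: int where "u - of_int k * (2 * pi * \<i>) = v + Ln (l * exp u / w0)"
        using Ln_branch_eq_up_to_period[OF assms(1) v(1) \<open>w0 \<noteq> 0\<close>] .
      ultimately show "u \<in> (\<Union>k. period_translate k Q)"
        by (auto simp: Q_def period_translate_def)
    qed
  qed
qed

section \<open>Power bounds for outer measures on the plane\<close>

text \<open>A pulled-back piece is cut into at most \<open>(8 / c + 1)\<^sup>2\<close> squares. The other factors bound the
  series over the branches.\<close>
definition pullback_const :: "real \<Rightarrow> real \<Rightarrow> real" where
  "pullback_const c s = 2 * (8 / c + 1)\<^sup>2 * (2 * c + 1) powr s / (s - 1)"

lemma pullback_const_pos: "0 < c \<Longrightarrow> 1 < s \<Longrightarrow> 0 < pullback_const c s"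
  by (auto simp: pullback_const_def add_pos_pos intro!: divide_pos_pos mult_pos_pos zero_less_power)

definition vertical_strip :: "real \<Rightarrow> real \<Rightarrow> complex set" where
  "vertical_strip x \<Delta> = {w. x \<le> Re w \<and> Re w \<le> x + \<Delta>}"

definition strip_const :: "real \<Rightarrow> real" where
  "strip_const s = 289 / (1 - 2 powr (1 - s))"

lemma strip_const_pos: "1 < s \<Longrightarrow> 0 < strip_const s"
  by (simp add: strip_const_def powr_less_one)

lemma dyadic_interval_obtains:
  fixes x y :: real
  assumes "0 < y" "y \<le> x"
  obtains m :: nat where "2 ^ m * y \<le> x" "x \<le> 2 * (2 ^ m * y)"
proof -
  obtain n where "x / y < 2 ^ n" using real_arch_pow[of 2] by auto
  then have "x < 2 ^ n * y" using assms(1) by (simp add: field_simps)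
  moreover have "\<not> x < 2 ^ 0 * y" using assms(2) by simp
  ultimately obtain m where "\<not> x < 2 ^ m * y" "x < 2 ^ Suc m * y"
    using ex_least_nat_less[of "\<lambda>n. x < 2 ^ n * y" n] by blast
  then show ?thesis using that[of m] by simp
qed

lemma outside_ball_subset_dyadic_annuli:
  fixes \<rho> :: real
  assumes "0 < \<rho>"
  shows "- ball 0 \<rho> \<subseteq> (\<Union>m::nat. cball 0 (2 * (2 ^ m * \<rho>)) - ball (0::complex) (2 ^ m * \<rho>))"
proof
  fix w :: complex assume "w \<in> - ball 0 \<rho>"
  then obtain m where "2 ^ m * \<rho> \<le> cmod w" "cmod w \<le> 2 * (2 ^ m * \<rho>)"
    using dyadic_interval_obtains[OF assms, of "cmod w"] by auto
  then show "w \<in> (\<Union>m::nat. cball 0 (2 * (2 ^ m * \<rho>)) - ball 0 (2 ^ m * \<rho>))"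
    by auto
qed

lemma divide_dyadic_powr:
  fixes x y t :: real
  shows "(x / (2 ^ m * y)) powr t = (x / y) powr t * (2 powr - t) ^ m"
proof -
  have "(x / (2 ^ m * y)) powr t = (x / y) powr t * (2 ^ m) powr - t"
    by (simp add: powr_divide powr_mult powr_minus_divide)
  also have "(2 ^ m) powr - t = (2 powr - t) ^ m"
    by (simp add: powr_powr mult.commute flip: powr_realpow)
  finally show ?thesis .
qed

text \<open>The bound is in terms of the diameter \<open>d\<close> relative to the distance \<open>r\<close> from the origin,
  because this is the diameter of the preimages under \<open>\<lambda>u. l * exp u\<close> up to a factor 2.\<close>
locale power_bounded_outer_measure =
  fixes \<mu> :: "complex set \<Rightarrow> ennreal" and s K \<rho> :: real
  assumes outer_measure: "outer_measure_space UNIV \<mu>"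
    and null_ball: "\<mu> (ball 0 \<rho>) = 0"
    and K_nonneg: "0 \<le> K"
    and power_bound: "\<And>P d r. \<lbrakk>diam_le P d; P \<subseteq> - ball 0 r; 0 < d; 2 * d \<le> r\<rbrakk>
      \<Longrightarrow> \<mu> P \<le> ennreal (K * (d / r) powr s)"
begin

lemma subset_cbox_bound:
  assumes "A \<subseteq> cbox p q" "cbox p q \<noteq> {}" "A \<subseteq> - ball 0 r" "0 < t" "4 * t \<le> r"
  shows "\<mu> A \<le> ennreal ((Re (q - p) / t + 1) * (Im (q - p) / t + 1) * (K * (2 * t / r) powr s))"
proof -
  obtain F where F: "finite F" "\<Union>F = A"
    "real (card F) \<le> (Re (q - p) / t + 1) * (Im (q - p) / t + 1)"
    "\<And>B. B \<in> F \<Longrightarrow> diam_le B (2 * t)"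
    by (rule cbox_grid_partition[OF assms(1,2,4)]) (simp add: Basis_complex_def)
  have "\<mu> A \<le> (\<Sum>B\<in>F. \<mu> B)"
    using outer_measure_space_finite_UN_le[OF outer_measure F(1), of id] F(2) by simp
  also have "\<dots> \<le> of_nat (card F) * ennreal (K * (2 * t / r) powr s)"
    using assms(3-5) F(2,4) by (intro sum_bounded_above power_bound) auto
  also have "\<dots> = ennreal (real (card F) * (K * (2 * t / r) powr s))"
    using K_nonneg by (simp add: ennreal_mult ennreal_of_nat_eq_real_of_nat)
  also have "\<dots> \<le> ennreal ((Re (q - p) / t + 1) * (Im (q - p) / t + 1) * (K * (2 * t / r) powr s))"
    using K_nonneg F(3) by (intro ennreal_leI mult_right_mono) auto
  finally show ?thesis .
qed

lemma diam_le_bound: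
  assumes "diam_le A d" "A \<subseteq> - ball 0 r" "0 < d" "0 < c" "c * d \<le> r"
  shows "\<mu> A \<le> ennreal ((8 / c + 1)\<^sup>2 * (K * (c * d / (2 * r)) powr s))"
proof (cases "A = {}")
  case True
  then show ?thesis by (simp add: outer_measure_space_empty[OF outer_measure])
next
  case False
  then obtain w0 where w0: "w0 \<in> A" by blast
  define p where "p = w0 - Complex d d"
  define q where "q = w0 + Complex d d"
  have "A \<subseteq> cbox p q"
  proof
    fix w assume "w \<in> A"
    then have "cmod (w - w0) \<le> d" using diam_leD[OF assms(1) _ w0] by (simp add: dist_norm)
    then show "w \<in> cbox p q"
      using abs_Re_le_cmod[of "w - w0"] abs_Im_le_cmod[of "w - w0"]
      by (auto simp: p_def q_def in_cbox_complex_iff)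
  qed
  then have "\<mu> A \<le> ennreal ((Re (q - p) / (c * d / 4) + 1) * (Im (q - p) / (c * d / 4) + 1) *
      (K * (2 * (c * d / 4) / r) powr s))"
    using assms w0 by (intro subset_cbox_bound) auto
  then show ?thesis
    using assms(3) by (simp add: p_def q_def power2_eq_square)
qed

lemma period_translate_bound:
  assumes "0 < c" "c \<le> \<rho>" "diam_le Q d" "0 < d" "d \<le> 1" "\<And>u. u \<in> Q \<Longrightarrow> \<bar>Im u\<bar> \<le> pi + 1"
  shows "\<mu> (period_translate k Q - ball 0 \<rho>)
    \<le> ennreal ((8 / c + 1)\<^sup>2 * K * (c * d / 2) powr s * max \<rho> \<bar>k\<bar> powr (- s))" (is "\<mu> ?T \<le> _")
proof -
  define r where "r = max \<rho> \<bar>real_of_int k\<bar>"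
  have r: "c \<le> r" "0 < r" using assms(1,2) by (auto simp: r_def)
  have "diam_le ?T d"
    using diam_le_period_translate[OF assms(3)] by (rule diam_le_subset) blast
  moreover have "?T \<subseteq> - ball 0 r"
    using period_translate_outside_ball[OF assms(6), of Q k] by (auto simp: r_def)
  moreover have "c * d \<le> r"
    using mult_left_le[of d c] assms(1,5) r(1) by linarith
  ultimately have "\<mu> ?T \<le> ennreal ((8 / c + 1)\<^sup>2 * (K * (c * d / (2 * r)) powr s))"
    using assms(1,4) by (intro diam_le_bound)
  also have "(c * d / (2 * r)) powr s = (c * d / 2) powr s * r powr (- s)"
    using assms(1,4) r(2) by (simp add: powr_divide powr_mult powr_minus field_simps)
  finally show ?thesis by (simp add: r_def mult.assoc)
qed

lemma exp_vimage_bound_suminf: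
  assumes "l \<noteq> 0" "0 < c" "c \<le> \<rho>"
    and P: "diam_le P d" "P \<subseteq> - ball 0 r" "0 < d" "2 * d \<le> r"
  shows "\<mu> ((\<lambda>u. l * exp u) -` P)
    \<le> 2 * (\<Sum>n. ennreal ((8 / c + 1)\<^sup>2 * K * (c * (d / r)) powr s * max \<rho> (real n) powr (- s)))"
proof -
  have r: "0 < r" using P(3,4) by simp
  obtain Q where Q: "diam_le Q (2 * d / r)" "\<And>u. u \<in> Q \<Longrightarrow> \<bar>Im u\<bar> \<le> pi + 1"
    "(\<lambda>u. l * exp u) -` P \<subseteq> (\<Union>k. period_translate k Q)"
    using exp_vimage_branch[OF assms(1) P(1,2) r P(4)] by blast
  have "\<mu> ((\<lambda>u. l * exp u) -` P) \<le> \<mu> ((\<lambda>u. l * exp u) -` P - ball 0 \<rho>)"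
    by (rule outer_measure_space_le_Diff_null[OF outer_measure null_ball])
  also have "\<dots> \<le> \<mu> (\<Union>k. period_translate k Q - ball 0 \<rho>)"
    using Q(3) by (intro outer_measure_space_mono[OF outer_measure]) blast
  also have "\<dots> \<le> 2 * (\<Sum>n. ennreal ((8 / c + 1)\<^sup>2 * K * (c * (d / r)) powr s *
      max \<rho> (real n) powr (- s)))"
  proof (rule outer_measure_space_UN_int_le[OF outer_measure])
    show "\<mu> (period_translate k Q - ball 0 \<rho>)
      \<le> ennreal ((8 / c + 1)\<^sup>2 * K * (c * (d / r)) powr s *
        max \<rho> (real (nat \<bar>k\<bar>)) powr (- s))" for k
      using period_translate_bound[OF assms(2,3) Q(1) _ _ Q(2), of k] P(3,4) r by simp
  qed
  finally show ?thesis .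
qed

lemma exp_vimage_bound:
  assumes "l \<noteq> 0" "0 < c" "c \<le> \<rho>" "1 < s"
    and P: "diam_le P d" "P \<subseteq> - ball 0 r" "0 < d" "2 * d \<le> r"
  shows "\<mu> ((\<lambda>u. l * exp u) -` P)
    \<le> ennreal (K * (pullback_const c s * \<rho> powr (1 - s)) * (d / r) powr s)"
proof -
  define X where "X = (8 / c + 1)\<^sup>2 * K * (c * (d / r)) powr s"
  have X: "0 \<le> X" using K_nonneg by (simp add: X_def)
  have "\<mu> ((\<lambda>u. l * exp u) -` P) \<le> 2 * (\<Sum>n. ennreal (X * max \<rho> (real n) powr (- s)))"
    unfolding X_def by (rule exp_vimage_bound_suminf[OF assms(1-3) P])
  also have "\<dots> \<le> 2 * ennreal (X * ((2 + 1 / c) powr s / (s - 1) * \<rho> powr (1 - s)))"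
    by (intro mult_left_mono suminf_max_powr_le assms(2-4) X) simp
  also have "\<dots> = ennreal (2 * (X * ((2 + 1 / c) powr s / (s - 1) * \<rho> powr (1 - s))))"
    by (subst ennreal_mult) (use X assms(4) in auto)
  also have "2 * (X * ((2 + 1 / c) powr s / (s - 1) * \<rho> powr (1 - s)))
      = K * (pullback_const c s * \<rho> powr (1 - s)) * (d / r) powr s"
  proof -
    have "(2 * c + 1) powr s = (c * (2 + 1 / c)) powr s"
      using assms(2) by (simp add: algebra_simps)
    then have "(2 * c + 1) powr s = c powr s * (2 + 1 / c) powr s"
      using assms(2) by (simp add: powr_mult)
    then show ?thesis
      using powr_mult[of c "d / r" s] by (simp add: X_def pullback_const_def)
  qed
  finally show ?thesis .
qed

lemma power_bounded_exp_vimage: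
  assumes "l \<noteq> 0" "0 < c" "c \<le> \<rho>" "1 < s"
  shows "power_bounded_outer_measure (\<lambda>P. \<mu> ((\<lambda>u. l * exp u) -` (P - ball 0 \<sigma>))) s
    (K * (pullback_const c s * \<rho> powr (1 - s))) \<sigma>"
proof
  have "(\<lambda>u. l * exp u) -` (P - ball 0 \<sigma>) = (\<lambda>u. l * exp u) -` P \<inter> (\<lambda>u. l * exp u) -` (- ball 0 \<sigma>)"
    for P :: "complex set"
    by blast
  then show "outer_measure_space UNIV (\<lambda>P. \<mu> ((\<lambda>u. l * exp u) -` (P - ball 0 \<sigma>)))"
    by (simp only: outer_measure_space_vimage_Int[OF outer_measure])
  show "\<mu> ((\<lambda>u. l * exp u) -` (ball 0 \<sigma> - ball 0 \<sigma>)) = 0"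
    by (simp add: outer_measure_space_empty[OF outer_measure])
  show "0 \<le> K * (pullback_const c s * \<rho> powr (1 - s))"
    using assms K_nonneg pullback_const_pos[of c s] by simp
next
  fix P :: "complex set" and d r
  assume P: "diam_le P d" "P \<subseteq> - ball 0 r" "0 < d" "2 * d \<le> r"
  have "diam_le (P - ball 0 \<sigma>) d"
    using P(1) by (rule diam_le_subset) blast
  then show "\<mu> ((\<lambda>u. l * exp u) -` (P - ball 0 \<sigma>))
      \<le> ennreal (K * (pullback_const c s * \<rho> powr (1 - s)) * (d / r) powr s)"
    using P by (intro exp_vimage_bound assms) auto
qed

text \<open>Squares of side \<open>min \<Delta> \<sigma> / 4\<close> serve for narrow strips as well as for strips wider than
  the annulus.\<close>
lemma strip_Int_annulus_bound:
  assumes "1 < s" "0 < \<Delta>" "0 < \<sigma>"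
  shows "\<mu> (vertical_strip x \<Delta> \<inter> (cball 0 (2 * \<sigma>) - ball 0 \<sigma>))
    \<le> ennreal (289 * K * (\<Delta> / \<sigma>) powr (s - 1))" (is "\<mu> ?A \<le> _")
proof -
  define h where "h = min \<Delta> \<sigma>"
  have h: "0 < h" "h \<le> \<sigma>" "h \<le> \<Delta>" using assms by (auto simp: h_def)
  define y where "y = (if \<Delta> \<le> \<sigma> then x else - 2 * \<sigma>)"
  define p where "p = Complex y (- 2 * \<sigma>)"
  define q where "q = Complex (y + 4 * h) (2 * \<sigma>)"
  have "?A \<subseteq> cbox p q"
  proof
    fix w assume w: "w \<in> ?A"
    then have "\<bar>Re w\<bar> \<le> 2 * \<sigma>" "\<bar>Im w\<bar> \<le> 2 * \<sigma>"
      using abs_Re_le_cmod[of w] abs_Im_le_cmod[of w] by auto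
    then show "w \<in> cbox p q"
      using w assms by (auto simp: p_def q_def y_def h_def in_cbox_complex_iff vertical_strip_def)
  qed
  moreover have "p \<in> cbox p q"
    using h assms(3) by (simp add: p_def q_def in_cbox_complex_iff)
  ultimately have "\<mu> ?A \<le> ennreal ((Re (q - p) / (h / 4) + 1) * (Im (q - p) / (h / 4) + 1) *
      (K * (2 * (h / 4) / \<sigma>) powr s))"
    using h by (intro subset_cbox_bound) auto
  also have "\<dots> \<le> ennreal ((17 * (17 * \<sigma> / h)) * (K * (h / \<sigma>) powr s))"
  proof (intro ennreal_leI mult_mono mult_left_mono powr_mono2)
    show "Im (q - p) / (h / 4) + 1 \<le> 17 * \<sigma> / h"
      using h by (simp add: p_def q_def field_simps)
  qed (use h assms K_nonneg in \<open>auto simp: p_def q_def divide_simps\<close>)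
  also have "(17 * (17 * \<sigma> / h)) * (K * (h / \<sigma>) powr s) = 289 * K * (h / \<sigma>) powr (s - 1)"
    using h assms(3) by (simp add: powr_diff)
  also have "ennreal \<dots> \<le> ennreal (289 * K * (\<Delta> / \<sigma>) powr (s - 1))"
    using h assms K_nonneg
    by (intro ennreal_leI mult_left_mono powr_mono2 divide_right_mono) auto
  finally show ?thesis .
qed

lemma strip_bound:
  assumes "1 < s" "0 < \<Delta>" "0 < \<rho>"
  shows "\<mu> (vertical_strip x \<Delta>) \<le> ennreal (K * strip_const s * (\<Delta> / \<rho>) powr (s - 1))"
proof -
  define S where "S = (\<lambda>m::nat. vertical_strip x \<Delta> \<inter>
    (cball 0 (2 * (2 ^ m * \<rho>)) - ball 0 (2 ^ m * \<rho>)))"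
  define X where "X = 289 * K * (\<Delta> / \<rho>) powr (s - 1)"
  have X: "0 \<le> X" using K_nonneg by (simp add: X_def)
  have annulus_bound: "\<mu> (S m) \<le> ennreal (X * (2 powr (1 - s)) ^ m)" for m
  proof -
    have "\<mu> (S m) \<le> ennreal (289 * K * (\<Delta> / (2 ^ m * \<rho>)) powr (s - 1))"
      unfolding S_def using assms by (intro strip_Int_annulus_bound) auto
    then show ?thesis
      unfolding divide_dyadic_powr by (simp add: X_def mult.assoc)
  qed
  have "\<mu> (vertical_strip x \<Delta>) \<le> \<mu> (vertical_strip x \<Delta> - ball 0 \<rho>)"
    by (rule outer_measure_space_le_Diff_null[OF outer_measure null_ball])
  also have "\<dots> \<le> \<mu> (\<Union>m. S m)"
    using outside_ball_subset_dyadic_annuli[OF assms(3)] unfolding S_def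
    by (intro outer_measure_space_mono[OF outer_measure]) blast
  also have "\<dots> \<le> (\<Sum>m. \<mu> (S m))"
    by (rule outer_measure_space_UN_le[OF outer_measure])
  also have "\<dots> \<le> (\<Sum>m. ennreal (X * (2 powr (1 - s)) ^ m))"
    by (intro suminf_le summableI annulus_bound)
  also have "\<dots> = ennreal (X * (1 / (1 - 2 powr (1 - s))))"
    using assms(1) X
    by (intro suminf_ennreal_eq sums_mult geometric_sums) (auto simp: powr_less_one)
  also have "X * (1 / (1 - 2 powr (1 - s))) = K * strip_const s * (\<Delta> / \<rho>) powr (s - 1)"
    by (simp add: X_def strip_const_def)
  finally show ?thesis .
qed

end

section \<open>Orbits\<close>

lemma power_bounded_hausdorff_content:
  assumes "0 \<le> s"
  shows "power_bounded_outer_measure (\<lambda>P. hausdorff_content s (P \<inter> (cball 0 R - ball 0 \<rho>))) s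
    (R powr s) \<rho>"
proof
  note outer = outer_measure_space_hausdorff_content[OF assms]
  show "outer_measure_space UNIV (\<lambda>P. hausdorff_content s (P \<inter> (cball 0 R - ball 0 \<rho>)))"
    using outer_measure_space_vimage_Int[OF outer, of id] by simp
  have "ball (0::complex) \<rho> \<inter> (cball 0 R - ball 0 \<rho>) = {}" by blast
  then show "hausdorff_content s (ball (0::complex) \<rho> \<inter> (cball 0 R - ball 0 \<rho>)) = 0"
    by (simp only: outer_measure_space_empty[OF outer])
  fix P :: "complex set" and d r
  assume P: "diam_le P d" "P \<subseteq> - ball 0 r" "0 < d" "2 * d \<le> r"
  show "hausdorff_content s (P \<inter> (cball 0 R - ball 0 \<rho>)) \<le> ennreal (R powr s * (d / r) powr s)"
  proof (cases "P \<inter> (cball 0 R - ball 0 \<rho>) = {}")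
    case True
    then show ?thesis by (simp add: outer_measure_space_empty[OF outer])
  next
    case False
    then have "r \<le> R" using P(2) by force
    have "hausdorff_content s (P \<inter> (cball 0 R - ball 0 \<rho>)) \<le> ennreal (d powr s)"
      using P(3) assms(1) diam_le_subset[OF P(1)] by (intro hausdorff_content_diam_le) auto
    also have "\<dots> \<le> ennreal ((R * (d / r)) powr s)"
      using \<open>r \<le> R\<close> P(3,4) assms(1)
      by (intro ennreal_leI powr_mono2) (auto simp: field_simps)
    also have "(R * (d / r)) powr s = R powr s * (d / r) powr s"
      by (rule powr_mult)
    finally show ?thesis .
  qed
qed simp

definition orbits_above :: "(nat \<Rightarrow> complex) \<Rightarrow> (nat \<Rightarrow> real) \<Rightarrow> real \<Rightarrow> nat \<Rightarrow> complex set" where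
  "orbits_above lam \<alpha> R n = {z. cmod z \<le> R \<and> (\<forall>i\<le>n. \<alpha> i \<le> cmod (exp_iter lam i z))}"

lemma orbits_above_0: "orbits_above lam \<alpha> R 0 = cball 0 R - ball 0 (\<alpha> 0)"
  by (auto simp: orbits_above_def)

lemma exp_iter_Suc_vimage_Int_orbits_above:
  "exp_iter lam (Suc n) -` P \<inter> orbits_above lam \<alpha> R (Suc n)
    = exp_iter lam n -` ((\<lambda>u. lam (Suc n) * exp u) -` (P - ball 0 (\<alpha> (Suc n))))
      \<inter> orbits_above lam \<alpha> R n"
  by (auto simp: orbits_above_def le_Suc_eq)

context
  fixes lam :: "nat \<Rightarrow> complex" and \<alpha> :: "nat \<Rightarrow> real" and c R s :: real
  assumes lam: "\<And>n. 1 \<le> n \<Longrightarrow> lam n \<noteq> 0" and c: "0 < c" "\<And>i. c \<le> \<alpha> i"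
    and s: "1 < s"
begin

lemma power_bounded_orbits_above:
  "power_bounded_outer_measure
    (\<lambda>P. hausdorff_content s (exp_iter lam n -` P \<inter> orbits_above lam \<alpha> R n)) s
    (R powr s * (\<Prod>i<n. pullback_const c s * \<alpha> i powr (1 - s))) (\<alpha> n)"
proof (induction n)
  case 0
  have "exp_iter lam 0 -` P = P" for P by auto
  then show ?case
    using power_bounded_hausdorff_content[of s R "\<alpha> 0"] s by (simp add: orbits_above_0)
next
  case (Suc n)
  from power_bounded_outer_measure.power_bounded_exp_vimage
    [OF Suc lam[of "Suc n"] c(1) c(2)[of n] s]
  show ?case
    unfolding exp_iter_Suc_vimage_Int_orbits_above by (simp add: mult.assoc)
qed

lemma hausdorff_content_strip_orbits_above_le:
  assumes "0 < \<Delta>"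
  shows "hausdorff_content s (exp_iter lam n -` vertical_strip x \<Delta> \<inter> orbits_above lam \<alpha> R n)
    \<le> ennreal (R powr s * strip_const s *
        (pullback_const c s ^ n * (\<Delta> / (\<Prod>i\<le>n. \<alpha> i)) powr (s - 1)))"
proof -
  have \<alpha>: "0 < \<alpha> i" for i using c(1) c(2)[of i] by linarith
  define p where "p = (\<Prod>i<n. \<alpha> i)"
  have p: "0 < p" unfolding p_def using \<alpha> by (intro prod_pos) auto
  have "(\<Prod>i<n. \<alpha> i powr (1 - s)) = p powr - (s - 1)"
    by (simp add: p_def prod_powr_distrib)
  also have "\<dots> = (1 / p) powr (s - 1)"
    unfolding powr_minus_divide using p by (simp add: powr_divide)
  finally have "(\<Prod>i<n. \<alpha> i powr (1 - s)) * (\<Delta> / \<alpha> n) powr (s - 1)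
      = (\<Delta> / (\<Prod>i\<le>n. \<alpha> i)) powr (s - 1)"
    by (simp add: p_def flip: powr_mult lessThan_Suc_atMost)
  then have "R powr s * (\<Prod>i<n. pullback_const c s * \<alpha> i powr (1 - s)) * strip_const s *
        (\<Delta> / \<alpha> n) powr (s - 1)
      = R powr s * strip_const s * (pullback_const c s ^ n * (\<Delta> / (\<Prod>i\<le>n. \<alpha> i)) powr (s - 1))"
    by (simp add: prod.distrib)
  then show ?thesis
    using power_bounded_outer_measure.strip_bound[OF power_bounded_orbits_above s assms \<alpha>, of n x]
    by (simp only:)
qed

end

lemma vertical_strip_if_cmod_exp_bounded:
  assumes "l \<noteq> 0" "0 < a" "0 < b" "a \<le> cmod (l * exp w)" "cmod (l * exp w) \<le> b"
  shows "w \<in> vertical_strip (ln (a / cmod l)) (ln (b / a))"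
proof -
  have "a / cmod l \<le> exp (Re w)" "exp (Re w) \<le> b / cmod l"
    using assms by (auto simp: norm_mult field_simps)
  then have "ln (a / cmod l) \<le> Re w" "Re w \<le> ln (b / cmod l)"
    using assms(1-3) ln_mono[of "a / cmod l" "exp (Re w)"] by (auto simp: ln_ge_iff)
  then show ?thesis
    using assms(1-3) by (auto simp: vertical_strip_def ln_div)
qed

definition bounded_orbits ::
    "(nat \<Rightarrow> complex) \<Rightarrow> (nat \<Rightarrow> real) \<Rightarrow> (nat \<Rightarrow> real) \<Rightarrow> real \<Rightarrow> nat \<Rightarrow> complex set" where
  "bounded_orbits lam \<alpha> b R N = {z. cmod z \<le> R \<and> (\<forall>i. \<alpha> i \<le> cmod (exp_iter lam i z)) \<and>
    (\<forall>i>N. cmod (exp_iter lam i z) \<le> b i)}"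

definition strip_ratio :: "(nat \<Rightarrow> real) \<Rightarrow> (nat \<Rightarrow> real) \<Rightarrow> nat \<Rightarrow> real" where
  "strip_ratio \<alpha> b n = ln (b (Suc n) / \<alpha> (Suc n)) / (\<Prod>i\<le>n. \<alpha> i)"

lemma bounded_orbits_subset_strip:
  assumes "lam (Suc n) \<noteq> 0" "0 < \<alpha> (Suc n)" "\<alpha> (Suc n) < b (Suc n)" "N \<le> n"
  shows "bounded_orbits lam \<alpha> b R N \<subseteq> exp_iter lam n -`
    vertical_strip (ln (\<alpha> (Suc n) / cmod (lam (Suc n)))) (ln (b (Suc n) / \<alpha> (Suc n)))
      \<inter> orbits_above lam \<alpha> R n"
proof
  fix z assume z: "z \<in> bounded_orbits lam \<alpha> b R N"
  then have "\<alpha> (Suc n) \<le> cmod (lam (Suc n) * exp (exp_iter lam n z))"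
    "cmod (lam (Suc n) * exp (exp_iter lam n z)) \<le> b (Suc n)"
    using assms(4) by (auto simp: bounded_orbits_def simp flip: exp_iter.simps(2))
  then have "exp_iter lam n z \<in>
      vertical_strip (ln (\<alpha> (Suc n) / cmod (lam (Suc n)))) (ln (b (Suc n) / \<alpha> (Suc n)))"
    using assms(1-3) by (intro vertical_strip_if_cmod_exp_bounded) auto
  then show "z \<in> exp_iter lam n -`
      vertical_strip (ln (\<alpha> (Suc n) / cmod (lam (Suc n)))) (ln (b (Suc n) / \<alpha> (Suc n)))
      \<inter> orbits_above lam \<alpha> R n"
    using z by (simp add: bounded_orbits_def orbits_above_def)
qed

lemma hausdorff_content_bounded_orbits_le:
  assumes lam: "\<And>n. 1 \<le> n \<Longrightarrow> lam n \<noteq> 0" and c: "0 < c" "\<And>i. c \<le> \<alpha> i"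
    and "1 < s" "N \<le> n" "\<alpha> (Suc n) < b (Suc n)"
  shows "hausdorff_content s (bounded_orbits lam \<alpha> b R N)
    \<le> ennreal (R powr s * strip_const s *
        (pullback_const c s ^ n * strip_ratio \<alpha> b n powr (s - 1)))"
proof -
  define S where "S =
    vertical_strip (ln (\<alpha> (Suc n) / cmod (lam (Suc n)))) (ln (b (Suc n) / \<alpha> (Suc n)))"
  have \<alpha>: "0 < \<alpha> (Suc n)" using less_le_trans[OF c] .
  have "hausdorff_content s (bounded_orbits lam \<alpha> b R N)
      \<le> hausdorff_content s (exp_iter lam n -` S \<inter> orbits_above lam \<alpha> R n)"
    using assms(4-6) lam[of "Suc n"] \<alpha> unfolding S_def
    by (intro outer_measure_space_mono[OF outer_measure_space_hausdorff_content]
        bounded_orbits_subset_strip) auto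
  also have "\<dots> \<le> ennreal (R powr s * strip_const s *
      (pullback_const c s ^ n * strip_ratio \<alpha> b n powr (s - 1)))"
    unfolding S_def strip_ratio_def
    by (intro hausdorff_content_strip_orbits_above_le assms) (use assms(6) \<alpha> in simp_all)
  finally show ?thesis .
qed

section \<open>Lower limits of roots\<close>

lemma frequently_less_if_Liminf_less:
  fixes f :: "'a \<Rightarrow> 'b::complete_linorder"
  assumes "Liminf F f < c"
  shows "\<exists>\<^sub>F x in F. f x < c"
proof (rule ccontr)
  assume "\<not> ?thesis"
  then have "c \<le> Liminf F f"
    by (intro Liminf_bounded) (simp add: not_frequently not_less)
  then show False using assms by simp
qed

lemma powr_le_power_if_root_le:
  fixes y \<tau> t :: real
  assumes "y powr (1 / real n) \<le> \<tau>" "0 \<le> y" "0 < n" "0 < t" "0 < \<tau>"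
  shows "y powr t \<le> (\<tau> powr t) ^ n"
proof -
  have "y powr t = ((y powr (1 / real n)) powr n) powr t"
    using assms(2,3) by (simp add: powr_powr)
  also have "\<dots> \<le> (\<tau> powr n) powr t"
    using assms by (intro powr_mono2) auto
  also have "\<dots> = (\<tau> powr t) ^ n"
    using assms(5) by (simp add: powr_powr mult.commute flip: powr_realpow)
  finally show ?thesis .
qed

lemma frequently_power_mult_powr_less:
  fixes y :: "nat \<Rightarrow> real"
  assumes "liminf (\<lambda>n. ereal (y n powr (1 / real n))) = 0" "\<forall>\<^sub>F n in sequentially. 0 \<le> y n"
    and "0 < C" "0 < t" "0 < \<epsilon>"
  shows "\<exists>\<^sub>F n in sequentially. C ^ n * y n powr t < \<epsilon>"
proof -
  define \<tau> where "\<tau> = (1 / (2 * C)) powr (1 / t)"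
  have \<tau>: "0 < \<tau>" "\<tau> powr t = 1 / (2 * C)"
    using assms(3,4) by (auto simp: \<tau>_def powr_powr)
  have "\<exists>\<^sub>F n in sequentially. ereal (y n powr (1 / real n)) < ereal \<tau>"
    using assms(1) \<tau>(1) by (intro frequently_less_if_Liminf_less) simp
  moreover have "(\<lambda>n. (1 / 2 :: real) ^ n) \<longlonglongrightarrow> 0"
    by (rule LIMSEQ_power_zero) simp
  then have "\<forall>\<^sub>F n in sequentially. (1 / 2) ^ n < \<epsilon>"
    using assms(5) by (rule order_tendstoD)
  moreover note assms(2) eventually_gt_at_top[of "0::nat"]
  ultimately have "\<exists>\<^sub>F n in sequentially. ereal (y n powr (1 / real n)) < ereal \<tau> \<and>
      ((1 / 2) ^ n < \<epsilon> \<and> 0 \<le> y n \<and> 0 < n)"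
    by (intro frequently_eventually_frequently eventually_conj)
  then show ?thesis
  proof (rule frequently_elim1)
    fix n assume n: "ereal (y n powr (1 / real n)) < ereal \<tau> \<and>
      ((1 / 2) ^ n < \<epsilon> \<and> 0 \<le> y n \<and> 0 < n)"
    then have "y n powr t \<le> (1 / (2 * C)) ^ n"
      using powr_le_power_if_root_le[of "y n" n \<tau> t] assms(4) \<tau> by simp
    then have "C ^ n * y n powr t \<le> C ^ n * (1 / (2 * C)) ^ n"
      using assms(3) by (intro mult_left_mono) auto
    also have "\<dots> = (1 / 2) ^ n"
      using assms(3) by (simp flip: power_mult_distrib)
    also have "\<dots> < \<epsilon>" using n by blast
    finally show "C ^ n * y n powr t < \<epsilon>" .
  qed
qed

lemma liminf_root_cmult:
  fixes y :: "nat \<Rightarrow> real"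
  assumes "0 < \<kappa>"
  shows "liminf (\<lambda>n. ereal ((\<kappa> * y n) powr (1 / real n)))
    = liminf (\<lambda>n. ereal (y n powr (1 / real n)))"
proof -
  have "(\<lambda>n. \<kappa> powr (1 / real n)) \<longlonglongrightarrow> \<kappa> powr 0"
    using assms(1) by (intro tendsto_powr tendsto_const lim_1_over_n) auto
  then have "(\<lambda>n. ereal (\<kappa> powr (1 / real n))) \<longlonglongrightarrow> ereal 1"
    using assms(1) by (intro tendsto_ereal) simp
  then have "liminf (\<lambda>n. ereal (\<kappa> powr (1 / real n)) * ereal (y n powr (1 / real n)))
      = ereal 1 * liminf (\<lambda>n. ereal (y n powr (1 / real n)))"
    by (rule ereal_liminf_lim_mult) auto
  then show ?thesis
    by (simp add: powr_mult flip: one_ereal_def)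
qed

lemma hausdorff_content_bounded_orbits_eq_0:
  assumes lam: "\<And>n. 1 \<le> n \<Longrightarrow> lam n \<noteq> 0" and c: "0 < c" "\<And>i. c \<le> \<alpha> i"
    and \<alpha>_less: "\<And>i. N < i \<Longrightarrow> \<alpha> i < b i" and R: "0 < R" and s: "1 < s"
    and lim: "liminf (\<lambda>n. ereal (strip_ratio \<alpha> b n powr (1 / real n))) = 0"
  shows "hausdorff_content s (bounded_orbits lam \<alpha> b R N) = 0" (is "hausdorff_content s ?Y = 0")
proof -
  define M where "M = R powr s * strip_const s"
  define C where "C = pullback_const c s"
  have M: "0 < M" and C: "0 < C"
    using R s c(1) by (simp_all add: M_def C_def strip_const_pos pullback_const_pos)
  have \<alpha>: "0 < \<alpha> i" for i using less_le_trans[OF c] .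
  have ratio_nonneg: "\<forall>\<^sub>F n in sequentially. 0 \<le> strip_ratio \<alpha> b n"
    using eventually_ge_at_top[of N]
  proof eventually_elim
    case (elim n)
    then show ?case
      using \<alpha>_less[of "Suc n"] \<alpha> by (simp add: strip_ratio_def prod_nonneg less_imp_le)
  qed
  have "hausdorff_content s ?Y \<le> 0 + ennreal \<epsilon>" if "0 < \<epsilon>" for \<epsilon>
  proof -
    have "\<exists>\<^sub>F n in sequentially. C ^ n * strip_ratio \<alpha> b n powr (s - 1) < \<epsilon> / M \<and> N \<le> n"
      using lim ratio_nonneg C s M that
      by (intro frequently_eventually_frequently frequently_power_mult_powr_less
          eventually_ge_at_top) auto
    then obtain n where n: "C ^ n * strip_ratio \<alpha> b n powr (s - 1) < \<epsilon> / M" "N \<le> n"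
      using frequently_ex by blast
    have "hausdorff_content s ?Y \<le> ennreal (M * (C ^ n * strip_ratio \<alpha> b n powr (s - 1)))"
      unfolding M_def C_def
      by (intro hausdorff_content_bounded_orbits_le lam c s n(2) \<alpha>_less) (use n(2) in auto)
    also have "\<dots> \<le> ennreal \<epsilon>"
      using n(1) M by (intro ennreal_leI) (simp add: field_simps)
    finally show ?thesis by simp
  qed
  then have "hausdorff_content s ?Y \<le> 0" by (rule ennreal_le_epsilon)
  then show ?thesis by simp
qed

section \<open>Change of finitely many lower bounds\<close>

lemma prod_eventually_eq:
  fixes a \<alpha> :: "nat \<Rightarrow> real"
  assumes "\<And>i. 0 < \<alpha> i" "\<And>i. 1 \<le> i \<Longrightarrow> 0 < a i" "\<And>i. N < i \<Longrightarrow> \<alpha> i = a i"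
  obtains \<kappa> where "0 < \<kappa>" "\<And>n. N \<le> n \<Longrightarrow> (\<Prod>i\<le>n. \<alpha> i) = \<kappa> * (\<Prod>i=1..n. a i)"
proof
  have a: "0 < (\<Prod>i=1..N. a i)" using assms(2) by (intro prod_pos) auto
  then show "0 < (\<Prod>i\<le>N. \<alpha> i) / (\<Prod>i=1..N. a i)"
    using assms(1) by (simp add: prod_pos)
  show "(\<Prod>i\<le>n. \<alpha> i) = (\<Prod>i\<le>N. \<alpha> i) / (\<Prod>i=1..N. a i) * (\<Prod>i=1..n. a i)" if "N \<le> n" for n
    using that
  proof (induction rule: dec_induct)
    case (step n)
    then show ?case using assms(3)[of "Suc n"] by simp
  qed (use less_imp_neq[OF a] in \<open>simp del: prod_zero_iff\<close>)
qed

definition replace_upto :: "nat \<Rightarrow> real \<Rightarrow> (nat \<Rightarrow> real) \<Rightarrow> nat \<Rightarrow> real" where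
  "replace_upto N c a i = (if i \<le> N then c else a i)"

lemma liminf_replace_upto:
  fixes a b :: "nat \<Rightarrow> real" and c :: real and N :: nat
  assumes "0 < c" and a_pos: "\<And>n. 1 \<le> n \<Longrightarrow> 0 < a n"
    and lim: "liminf (\<lambda>n. ereal ((ln (b (n+1) / a (n+1)) / (\<Prod>k=1..n. a k)) powr (1 / real n))) = 0"
  defines "\<alpha> \<equiv> replace_upto N c a"
  shows "liminf (\<lambda>n. ereal (strip_ratio \<alpha> b n powr (1 / real n))) = 0"
proof -
  obtain \<kappa> where \<kappa>: "0 < \<kappa>" "\<And>n. N \<le> n \<Longrightarrow> (\<Prod>i\<le>n. \<alpha> i) = \<kappa> * (\<Prod>i=1..n. a i)"
    by (rule prod_eventually_eq[of \<alpha> a N])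
      (use assms(1) a_pos in \<open>auto simp: \<alpha>_def replace_upto_def\<close>)
  define y where "y = (\<lambda>n. ln (b (n+1) / a (n+1)) / (\<Prod>k=1..n. a k))"
  have "\<forall>\<^sub>F n in sequentially. strip_ratio \<alpha> b n = 1 / \<kappa> * y n"
    using eventually_ge_at_top[of N]
  proof eventually_elim
    case (elim n)
    then show ?case using \<kappa>(2)[OF elim] by (simp add: strip_ratio_def y_def \<alpha>_def replace_upto_def)
  qed
  then have "liminf (\<lambda>n. ereal (strip_ratio \<alpha> b n powr (1 / real n)))
      = liminf (\<lambda>n. ereal ((1 / \<kappa> * y n) powr (1 / real n)))"
    by (intro Liminf_eq) (auto elim: eventually_mono)
  also have "\<dots> = liminf (\<lambda>n. ereal (y n powr (1 / real n)))"
    using \<kappa>(1) by (intro liminf_root_cmult) auto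
  finally show ?thesis using lim by (simp add: y_def)
qed

lemma I_set_subset_UN_bounded_orbits:
  assumes "\<And>n. 1 \<le> n \<Longrightarrow> lam n \<noteq> 0"
  shows "I_set lam a b \<subseteq>
    {0} \<union> (\<Union>N m. bounded_orbits lam (replace_upto N (1 / real (Suc m)) a) b (real (Suc m)) N)"
    (is "_ \<subseteq> {0} \<union> (\<Union>N m. ?Y N m)")
proof
  fix z assume "z \<in> I_set lam a b"
  then obtain N where N: "\<And>n. N \<le> n \<Longrightarrow> a n \<le> cmod (exp_iter lam n z) \<and> cmod (exp_iter lam n z) \<le> b n"
    by (auto simp: I_set_def eventually_sequentially)
  show "z \<in> {0} \<union> (\<Union>N m. ?Y N m)"
  proof (cases "z = 0")
    case False
    then have nz: "exp_iter lam i z \<noteq> 0" for i using assms by (cases i) auto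
    define \<mu> where "\<mu> = Min ((\<lambda>i. cmod (exp_iter lam i z)) ` {..N})"
    have \<mu>: "0 < \<mu>" "\<And>i. i \<le> N \<Longrightarrow> \<mu> \<le> cmod (exp_iter lam i z)"
      using nz by (auto simp: \<mu>_def)
    obtain m where m: "max (1 / \<mu>) (cmod z) \<le> real m" using real_arch_simple by blast
    have "1 / real (Suc m) \<le> \<mu>"
      using m \<mu>(1) by (simp add: field_simps)
    then have "z \<in> ?Y N m"
      using N \<mu>(2) m by (force simp: bounded_orbits_def replace_upto_def)
    then show ?thesis by blast
  qed simp
qed

lemma hausdorff_content_I_set_eq_0:
  assumes lam: "\<And>n. 1 \<le> n \<Longrightarrow> lam n \<noteq> 0" and ab: "\<And>n. 1 \<le> n \<Longrightarrow> 0 < a n \<and> a n < b n"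
    and c: "0 < c" "\<And>n. 1 \<le> n \<Longrightarrow> c \<le> a n"
    and lim: "liminf (\<lambda>n. ereal ((ln (b (n+1) / a (n+1)) / (\<Prod>k=1..n. a k)) powr (1 / real n))) = 0"
    and s: "1 < s"
  shows "hausdorff_content s (I_set lam a b) = 0"
proof -
  define Y where "Y =
    (\<lambda>N m. bounded_orbits lam (replace_upto N (1 / real (Suc m)) a) b (real (Suc m)) N)"
  have outer: "outer_measure_space UNIV (hausdorff_content s :: complex set \<Rightarrow> ennreal)"
    using s by (intro outer_measure_space_hausdorff_content) simp
  have "hausdorff_content s (Y N m) = 0" for N m
    unfolding Y_def
  proof (rule hausdorff_content_bounded_orbits_eq_0[where c = "min c (1 / real (Suc m))"])
    show "min c (1 / real (Suc m)) \<le> replace_upto N (1 / real (Suc m)) a i" for i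
      using c(2)[of i] by (auto simp: replace_upto_def)
    show "replace_upto N (1 / real (Suc m)) a i < b i" if "N < i" for i
      using that ab[of i] by (simp add: replace_upto_def)
    show "liminf (\<lambda>n. ereal
        (strip_ratio (replace_upto N (1 / real (Suc m)) a) b n powr (1 / real n))) = 0"
      using ab lim by (intro liminf_replace_upto) auto
  qed (use lam c(1) s in auto)
  then have "hausdorff_content s (\<Union>N m. Y N m) = 0"
    by (intro outer_measure_space_null_UN[OF outer])
  moreover have "hausdorff_content s {0::complex} = 0"
    using hausdorff_content_diam_le[of "{0::complex}" 0 s] s by (simp add: diam_le_def)
  ultimately have "hausdorff_content s ({0} \<union> (\<Union>N m. Y N m)) \<le> 0"
    using outer_measure_space_Un_le[OF outer, of "{0}" "\<Union>N m. Y N m"] by simp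
  moreover have "hausdorff_content s (I_set lam a b) \<le> hausdorff_content s ({0} \<union> (\<Union>N m. Y N m))"
    using I_set_subset_UN_bounded_orbits[OF lam] unfolding Y_def
    by (rule outer_measure_space_mono[OF outer])
  ultimately show ?thesis by simp
qed

theorem theorem2p1:
  fixes lam :: "nat \<Rightarrow> complex" and a b :: "nat \<Rightarrow> real"
  assumes "\<forall>n\<ge>1. lam n \<noteq> 0"
    and "\<forall>n\<ge>1. 0 < a n \<and> a n < b n"
    and "(INF n \<in> {1..}. a n) > 0"
    and "liminf (\<lambda>n. ereal ((ln (b (n+1) / a (n+1)) / (\<Prod>k=1..n. a k)) powr (1 / real n))) = 0"
  shows "hausdorff_dim (I_set lam a b) \<le> 1"
proof -
  have "bdd_below (a ` {1..})"
    using assms(2) by (intro bdd_belowI[of _ 0]) (auto intro: less_imp_le)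
  then have INF_le: "(INF n \<in> {1..}. a n) \<le> a n" if "1 \<le> n" for n
    using that by (intro cINF_lower) auto
  have "hausdorff_content s (I_set lam a b) = 0" if "1 < s" for s
    using assms(1,2)
    by (intro hausdorff_content_I_set_eq_0[OF _ _ assms(3) INF_le assms(4) that]) auto
  then show ?thesis
    using hausdorff_dim_le[of 1 "I_set lam a b"] by (simp add: one_ereal_def)
qed

end
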